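(* Let $n\ge 2$ and let $N=A^+(B_n)\setminus A^+(B_n)_{n^2+1}$, the set of elements of $A^+(B_n)$ that are not of full support. Then $(N,\circ)$ is an inverse semigroup (in particular, $N$ is closed under $\circ$).
   Context: For $n\ge 1$ let $[n]=\{1,\dots,n\}$. The Brandt semigroup $(B_n,+)$ has underlying set $B_n=([n]\times[n])\cup\{\vartheta\}$ with $(i,j)+(k,l)=(i,l)$ if $j=k$, $(i,j)+(k,l)=\vartheta$ if $j\ne k$, and $\alpha+\vartheta=\vartheta+\alpha=\vartheta$ for all $\alpha\in B_n$. $M(B_n)$ is the set of all maps $B_n\to B_n$; arguments are written on the left of functions. It carries pointwise addition $\alpha(f+g)=\alpha f+\alpha g$ and composition $\alpha(f\circ g)=(\alpha f)g$. An affine map over $B_n$ is a map of the form $g+h$ with $g$ an endomorphism of the semigroup $(B_n,+)$ (not required to fix $\vartheta$) and $h\in M(B_n)$ a constant map. $A^+(B_n)$ (the affine near-semiring over $B_n$) is the smallest subset of $M(B_n)$ that contains all affine maps and is closed under $+$ and $\circ$. The support of $f\in M(B_n)$ is $\mathrm{supp}(f)=\{\alpha\in B_n : \alpha f\neq\vartheta\}$, and $A^+(B_n)_k$ is the set of $f\in A^+(B_n)$ with $|\mathrm{supp}(f)|=k$. *)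

theory Defs
  imports Main "HOL-Library.FuncSet"
begin

datatype brandt = Theta | Elt nat nat

definition brandt_carrier :: "nat \<Rightarrow> brandt set" where
  "brandt_carrier n = {Elt i j | i j. i \<in> {1..n} \<and> j \<in> {1..n}} \<union> {Theta}"

fun brandt_add :: "brandt \<Rightarrow> brandt \<Rightarrow> brandt" where
  "brandt_add (Elt i j) (Elt k l) = (if j = k then Elt i l else Theta)"
| "brandt_add (Elt i j) Theta = Theta"
| "brandt_add Theta x = Theta"

text \<open>
  The set \<open>M(B\<^sub>n)\<close>. Maps are extensional (undefined outside the carrier), so that HOL
  equality of functions is equality of maps on \<open>B\<^sub>n\<close>.
\<close>
definition brandt_maps :: "nat \<Rightarrow> (brandt \<Rightarrow> brandt) set" where
  "brandt_maps n = brandt_carrier n \<rightarrow>\<^sub>E brandt_carrier n"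

definition map_add :: "nat \<Rightarrow> (brandt \<Rightarrow> brandt) \<Rightarrow> (brandt \<Rightarrow> brandt) \<Rightarrow> (brandt \<Rightarrow> brandt)" where
  "map_add n f g = (\<lambda>x\<in>brandt_carrier n. brandt_add (f x) (g x))"

text \<open>Arguments are written on the left of maps: first apply \<open>f\<close>, then \<open>g\<close>.\<close>
definition map_mult :: "nat \<Rightarrow> (brandt \<Rightarrow> brandt) \<Rightarrow> (brandt \<Rightarrow> brandt) \<Rightarrow> (brandt \<Rightarrow> brandt)" where
  "map_mult n f g = compose (brandt_carrier n) g f"

definition brandt_endomorphisms :: "nat \<Rightarrow> (brandt \<Rightarrow> brandt) set" where
  "brandt_endomorphisms n = {g \<in> brandt_maps n.
     \<forall>x\<in>brandt_carrier n. \<forall>y\<in>brandt_carrier n. g (brandt_add x y) = brandt_add (g x) (g y)}"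

definition constant_maps :: "nat \<Rightarrow> (brandt \<Rightarrow> brandt) set" where
  "constant_maps n = {h \<in> brandt_maps n. \<exists>c. \<forall>x\<in>brandt_carrier n. h x = c}"

definition affine_maps :: "nat \<Rightarrow> (brandt \<Rightarrow> brandt) set" where
  "affine_maps n = {map_add n g h | g h. g \<in> brandt_endomorphisms n \<and> h \<in> constant_maps n}"

inductive_set affine_nearsemiring :: "nat \<Rightarrow> (brandt \<Rightarrow> brandt) set" for n :: nat where
  affine: "f \<in> affine_maps n \<Longrightarrow> f \<in> affine_nearsemiring n"
| add: "f \<in> affine_nearsemiring n \<Longrightarrow> g \<in> affine_nearsemiring n
    \<Longrightarrow> map_add n f g \<in> affine_nearsemiring n"
| mult: "f \<in> affine_nearsemiring n \<Longrightarrow> g \<in> affine_nearsemiring n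
    \<Longrightarrow> map_mult n f g \<in> affine_nearsemiring n"

definition map_support :: "nat \<Rightarrow> (brandt \<Rightarrow> brandt) \<Rightarrow> brandt set" where
  "map_support n f = {x \<in> brandt_carrier n. f x \<noteq> Theta}"

definition affine_nearsemiring_supp :: "nat \<Rightarrow> nat \<Rightarrow> (brandt \<Rightarrow> brandt) set" where
  "affine_nearsemiring_supp n k = {f \<in> affine_nearsemiring n. card (map_support n f) = k}"

definition semigroup_on :: "'a set \<Rightarrow> ('a \<Rightarrow> 'a \<Rightarrow> 'a) \<Rightarrow> bool" where
  "semigroup_on S m \<longleftrightarrow> S \<noteq> {} \<and> (\<forall>a\<in>S. \<forall>b\<in>S. m a b \<in> S) \<and>
     (\<forall>a\<in>S. \<forall>b\<in>S. \<forall>c\<in>S. m (m a b) c = m a (m b c))"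

definition inverse_semigroup_on :: "'a set \<Rightarrow> ('a \<Rightarrow> 'a \<Rightarrow> 'a) \<Rightarrow> bool" where
  "inverse_semigroup_on S m \<longleftrightarrow> semigroup_on S m \<and>
     (\<forall>a\<in>S. \<exists>!b. b \<in> S \<and> m (m a b) a = a \<and> m (m b a) b = b)"

lemma brandt_add_closed:
  "x \<in> brandt_carrier n \<Longrightarrow> y \<in> brandt_carrier n \<Longrightarrow> brandt_add x y \<in> brandt_carrier n"
  by (cases x; cases y) (auto simp: brandt_carrier_def)

lemma brandt_add_assoc: "brandt_add (brandt_add x y) z = brandt_add x (brandt_add y z)"
  by (cases x; cases y; cases z) auto

lemma map_add_closed:
  "f \<in> brandt_maps n \<Longrightarrow> g \<in> brandt_maps n \<Longrightarrow> map_add n f g \<in> brandt_maps n"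
  by (auto simp: brandt_maps_def map_add_def intro!: brandt_add_closed)

lemma map_mult_closed:
  "f \<in> brandt_maps n \<Longrightarrow> g \<in> brandt_maps n \<Longrightarrow> map_mult n f g \<in> brandt_maps n"
  by (auto simp: brandt_maps_def map_mult_def compose_def)

lemma affine_nearsemiring_subset: "affine_nearsemiring n \<subseteq> brandt_maps n"
proof
  fix f assume "f \<in> affine_nearsemiring n"
  then show "f \<in> brandt_maps n"
    by induction (auto simp: affine_maps_def brandt_endomorphisms_def constant_maps_def
        intro: map_add_closed map_mult_closed)
qed

end

theory Submission
  imports Defs
begin

text \<open>
  A non-constant endomorphism of \<open>B\<^sub>n\<close> permutes indices, so adding a nonzero constant to it leaves a
  map supported on one column \<open>{(i, k) | i}\<close> and carrying it bijectively onto another column.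
  Sums of two such maps are supported on at most one element. Hence, besides the nonzero constant maps,
  which have full support, \<open>A\<^sup>+(B\<^sub>n)\<close> consists of injective partial maps between columns that are
  total on the column or have at most one element. These are closed under composition and under
  inversion of partial injections, and inverses of partial injections are unique.
\<close>

section \<open>Normal forms of maps\<close>

text \<open>The map depends on \<open>s\<close> only through its values on \<open>D\<close>, so the
  parameters are not unique; an empty \<open>D\<close> yields the zero map.\<close>

definition column_map :: "nat \<Rightarrow> nat \<Rightarrow> nat \<Rightarrow> nat set \<Rightarrow> (nat \<Rightarrow> nat) \<Rightarrow> brandt \<Rightarrow> brandt" where
  "column_map n k q D s = (\<lambda>x\<in>brandt_carrier n.
     case x of Elt i j \<Rightarrow> if j = k \<and> i \<in> D then Elt (s i) q else Theta | Theta \<Rightarrow> Theta)"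

text \<open>The last condition separates total maps from the fragments that sums leave behind;
  intermediate domains never arise from sums or composites.\<close>

definition column_maps :: "nat \<Rightarrow> (brandt \<Rightarrow> brandt) set" where
  "column_maps n = {column_map n k q D s | k q D s. k \<in> {1..n} \<and> q \<in> {1..n} \<and> D \<subseteq> {1..n} \<and>
     inj_on s D \<and> s ` D \<subseteq> {1..n} \<and> (D = {1..n} \<or> (\<exists>j. D \<subseteq> {j}))}"

definition constant_map :: "nat \<Rightarrow> brandt \<Rightarrow> brandt \<Rightarrow> brandt" where
  "constant_map n c = (\<lambda>x\<in>brandt_carrier n. c)"

text \<open>For a permutation \<open>s\<close> of \<open>{1..n}\<close> this is the automorphism of
  \<open>B\<^sub>n\<close> that relabels indices.\<close>

definition index_map :: "nat \<Rightarrow> (nat \<Rightarrow> nat) \<Rightarrow> brandt \<Rightarrow> brandt" where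
  "index_map n s = (\<lambda>x\<in>brandt_carrier n. case x of Elt i j \<Rightarrow> Elt (s i) (s j) | Theta \<Rightarrow> Theta)"

section \<open>Arithmetic and size of the Brandt semigroup\<close>

lemma Elt_in_carrier [simp]: "Elt i j \<in> brandt_carrier n \<longleftrightarrow> i \<in> {1..n} \<and> j \<in> {1..n}"
  by (auto simp: brandt_carrier_def)

lemma Theta_in_carrier [simp]: "Theta \<in> brandt_carrier n"
  by (simp add: brandt_carrier_def)

lemma brandt_add_Theta_right [simp]: "brandt_add x Theta = Theta"
  by (cases x) auto

text \<open>For \<open>e = Elt i j\<close> the equations force \<open>a = Elt i i\<close> and
  \<open>a = Elt j j\<close>. With \<open>e = g Theta\<close> this makes every endomorphism
  \<open>g\<close> that moves \<open>Theta\<close> constant.\<close>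

lemma brandt_add_absorbing_eq:
  "brandt_add a e = e \<Longrightarrow> brandt_add e a = e \<Longrightarrow> e \<noteq> Theta \<Longrightarrow> a = e"
  by (cases a; cases e) (auto split: if_splits)

lemma brandt_idempotent_cases: "brandt_add a a = a \<Longrightarrow> a = Theta \<or> (\<exists>k. a = Elt k k)"
  by (cases a) (auto split: if_splits)

text \<open>A left unit fixes the first index of \<open>a\<close>, a right unit the second. This
  locates the image of \<open>Elt i j\<close> from those of \<open>Elt i i\<close> and
  \<open>Elt j j\<close>.\<close>

lemma brandt_add_idempotent_units:
  assumes "brandt_add (Elt p p) a = a" "brandt_add a (Elt q q) = a" "a \<noteq> Theta"
  shows "a = Elt p q"
proof -
  obtain i j where a: "a = Elt i j"
    using assms(3) by (cases a) auto
  have "p = i"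
  proof (rule ccontr)
    assume "p \<noteq> i"
    then have "brandt_add (Elt p p) a = Theta" by (simp add: a)
    then show False using assms(1,3) by metis
  qed
  moreover have "q = j"
  proof (rule ccontr)
    assume "q \<noteq> j"
    then have "brandt_add a (Elt q q) = Theta" by (simp add: a)
    then show False using assms(2,3) by metis
  qed
  ultimately show ?thesis by (simp add: a)
qed

lemma brandt_carrier_eq: "brandt_carrier n = insert Theta (case_prod Elt ` ({1..n} \<times> {1..n}))"
  by (auto simp: brandt_carrier_def)

lemma finite_brandt_carrier: "finite (brandt_carrier n)"
  by (simp add: brandt_carrier_eq)

lemma card_brandt_carrier: "card (brandt_carrier n) = n\<^sup>2 + 1"
proof -
  have "inj_on (case_prod Elt) ({1..n} \<times> {1..n})"
    by (auto simp: inj_on_def)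
  then show ?thesis
    unfolding brandt_carrier_eq
    by (subst card_insert_disjoint) (auto simp: card_image power2_eq_square)
qed

lemma column_mapsI:
  assumes "k \<in> {1..n}" "q \<in> {1..n}" "D \<subseteq> {1..n}" "inj_on s D" "s ` D \<subseteq> {1..n}"
    "D = {1..n} \<or> (\<exists>j. D \<subseteq> {j})"
  shows "column_map n k q D s \<in> column_maps n"
  using assms unfolding column_maps_def by blast

lemma column_mapsE:
  assumes "f \<in> column_maps n"
  obtains k q D s where "f = column_map n k q D s" "k \<in> {1..n}" "q \<in> {1..n}" "D \<subseteq> {1..n}"
    "inj_on s D" "s ` D \<subseteq> {1..n}" "D = {1..n} \<or> (\<exists>j. D \<subseteq> {j})"
  using assms unfolding column_maps_def mem_Collect_eq by (elim exE conjE) (rule that)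

lemma constant_map_Theta: "constant_map n Theta = column_map n k q {} s"
  by (auto simp: constant_map_def column_map_def fun_eq_iff split: brandt.split)

lemma constant_map_Theta_in_column_maps: "n \<ge> 1 \<Longrightarrow> constant_map n Theta \<in> column_maps n"
  by (subst constant_map_Theta[of n 1 1 id]) (auto intro!: column_mapsI)

section \<open>Endomorphisms and constant maps\<close>

text \<open>If \<open>Theta\<close> moves, its image absorbs every value. If \<open>Theta\<close> is
  fixed and some \<open>Elt i j\<close> is killed, everything is. Otherwise each idempotent
  \<open>Elt i i\<close> goes to a nonzero idempotent, which defines \<open>s\<close>.\<close>

lemma endomorphism_cases:
  assumes g: "g \<in> brandt_endomorphisms n"
  obtains (const) c where "c \<in> brandt_carrier n" "g = constant_map n c"
  | (index) s where "inj_on s {1..n}" "s ` {1..n} \<subseteq> {1..n}" "g = index_map n s"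
proof -
  have maps: "g x \<in> brandt_carrier n" if "x \<in> brandt_carrier n" for x
    using g that by (auto simp: brandt_endomorphisms_def brandt_maps_def)
  have ext: "g x = undefined" if "x \<notin> brandt_carrier n" for x
    using g that by (auto simp: brandt_endomorphisms_def brandt_maps_def intro: PiE_arb)
  have hom: "g (brandt_add x y) = brandt_add (g x) (g y)"
    if "x \<in> brandt_carrier n" "y \<in> brandt_carrier n" for x y
    using g that by (auto simp: brandt_endomorphisms_def)
  have constI: thesis if "\<And>x. x \<in> brandt_carrier n \<Longrightarrow> g x = g Theta"
  proof (rule const)
    show "g Theta \<in> brandt_carrier n" by (simp add: maps)
    show "g = constant_map n (g Theta)"
    proof
      fix x show "g x = constant_map n (g Theta) x"
        using that[of x] ext[of x] by (simp add: constant_map_def)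
    qed
  qed
  show thesis
  proof (cases "g Theta = Theta")
    case False
    have "g x = g Theta" if "x \<in> brandt_carrier n" for x
    proof (rule brandt_add_absorbing_eq[OF _ _ False])
      show "brandt_add (g x) (g Theta) = g Theta"
        using hom[OF that Theta_in_carrier] by (simp only: brandt_add_Theta_right)
      show "brandt_add (g Theta) (g x) = g Theta"
        using hom[OF Theta_in_carrier that] by (simp only: brandt_add.simps)
    qed
    then show thesis by (rule constI)
  next
    case zero: True
    show thesis
    proof (cases "\<exists>i\<in>{1..n}. \<exists>j\<in>{1..n}. g (Elt i j) = Theta")
      case True
      then obtain i j where ij: "i \<in> {1..n}" "j \<in> {1..n}" "g (Elt i j) = Theta" by blast
      \<comment> \<open>\<open>Elt a b\<close> is the sum of \<open>Elt a i\<close>,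
        \<open>Elt i j\<close> and \<open>Elt j b\<close>, so killing the middle term kills
        it.\<close>
      have "g (Elt a b) = Theta" if "a \<in> {1..n}" "b \<in> {1..n}" for a b
        using hom[of "Elt a i" "Elt i b"] hom[of "Elt i j" "Elt j b"] ij that by simp
      then have "g x = g Theta" if "x \<in> brandt_carrier n" for x
        using that zero by (cases x) auto
      then show thesis by (rule constI)
    next
      case False
      have idem: "\<exists>k\<in>{1..n}. g (Elt i i) = Elt k k" if "i \<in> {1..n}" for i
      proof -
        have "brandt_add (g (Elt i i)) (g (Elt i i)) = g (Elt i i)"
          using hom[of "Elt i i" "Elt i i", symmetric] that by simp
        then obtain k where "g (Elt i i) = Elt k k"
          using brandt_idempotent_cases False \<open>i \<in> {1..n}\<close> by metis
        then show ?thesis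
          using maps[of "Elt i i"] that by auto
      qed
      then obtain s where s: "\<And>i. i \<in> {1..n} \<Longrightarrow> s i \<in> {1..n} \<and> g (Elt i i) = Elt (s i) (s i)"
        by metis
      have eq: "g (Elt i j) = Elt (s i) (s j)" if "i \<in> {1..n}" "j \<in> {1..n}" for i j
      proof (rule brandt_add_idempotent_units)
        show "brandt_add (Elt (s i) (s i)) (g (Elt i j)) = g (Elt i j)"
          using hom[of "Elt i i" "Elt i j", symmetric] s[OF that(1)] that by simp
        show "brandt_add (g (Elt i j)) (Elt (s j) (s j)) = g (Elt i j)"
          using hom[of "Elt i j" "Elt j j", symmetric] s[OF that(2)] that by simp
        show "g (Elt i j) \<noteq> Theta"
          using False that by blast
      qed
      \<comment> \<open>Distinct idempotents \<open>Elt i i\<close> and \<open>Elt j j\<close> add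
        up to \<open>Theta\<close>, whereas a common nonzero idempotent image added to itself stays
        nonzero.\<close>
      have "i = j" if "i \<in> {1..n}" "j \<in> {1..n}" "s i = s j" for i j
      proof (rule ccontr)
        assume "i \<noteq> j"
        then have "g Theta = Elt (s j) (s j)"
          using hom[of "Elt i i" "Elt j j"] s[OF that(1)] s[OF that(2)] that by simp
        then show False using zero by simp
      qed
      then have "inj_on s {1..n}" by (auto simp: inj_on_def)
      moreover have "g = index_map n s"
      proof
        fix x show "g x = index_map n s x"
          using zero ext eq by (cases x) (auto simp: index_map_def)
      qed
      ultimately show thesis using s by (intro index) auto
    qed
  qed
qed

lemma constant_mapsE:
  assumes "h \<in> constant_maps n"
  obtains c where "c \<in> brandt_carrier n" "h = constant_map n c"
proof -
  from assms obtain c where h: "h \<in> brandt_maps n" "\<And>x. x \<in> brandt_carrier n \<Longrightarrow> h x = c"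
    by (auto simp: constant_maps_def)
  have "h Theta \<in> brandt_carrier n"
    using h(1) Theta_in_carrier unfolding brandt_maps_def by (rule PiE_mem)
  then have "c \<in> brandt_carrier n"
    using h(2) by simp
  moreover have "h = constant_map n c"
  proof
    fix x show "h x = constant_map n c x"
      using h(2)[of x] PiE_arb[OF h(1)[unfolded brandt_maps_def], of x]
      by (cases "x \<in> brandt_carrier n") (simp_all add: constant_map_def)
  qed
  ultimately show thesis by (rule that)
qed

lemma constant_map_in_constant_maps: "c \<in> brandt_carrier n \<Longrightarrow> constant_map n c \<in> constant_maps n"
  by (auto simp: constant_maps_def constant_map_def brandt_maps_def)

lemma constant_map_in_endomorphisms:
  assumes "c \<in> brandt_carrier n" "brandt_add c c = c"
  shows "constant_map n c \<in> brandt_endomorphisms n"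
  using assms
  by (auto simp: brandt_endomorphisms_def constant_map_def brandt_maps_def brandt_add_closed)

text \<open>Injectivity keeps mismatched inner indices mismatched, so sums equal to
  \<open>Theta\<close> are respected.\<close>

lemma index_map_in_endomorphisms:
  assumes "inj_on s {1..n}" "s ` {1..n} \<subseteq> {1..n}"
  shows "index_map n s \<in> brandt_endomorphisms n"
proof -
  have "index_map n s x \<in> brandt_carrier n" if "x \<in> brandt_carrier n" for x
    using assms(2) that by (cases x) (auto simp: index_map_def image_subset_iff)
  moreover have "index_map n s (brandt_add x y) = brandt_add (index_map n s x) (index_map n s y)"
    if "x \<in> brandt_carrier n" "y \<in> brandt_carrier n" for x y
    using assms that
    by (cases x; cases y) (auto simp: index_map_def dest: inj_onD)
  ultimately show ?thesis
    by (auto simp: brandt_endomorphisms_def brandt_maps_def index_map_def)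
qed

section \<open>Sums and composites in normal form\<close>

lemma map_add_constant: "map_add n (constant_map n c) (constant_map n d) = constant_map n (brandt_add c d)"
  by (auto simp: map_add_def constant_map_def)

text \<open>The inner indices \<open>s j\<close> and \<open>s k\<close> match only for
  \<open>j = k\<close>, by injectivity; this is how a single column arises.\<close>

lemma map_add_index_constant:
  assumes "inj_on s {1..n}" "k \<in> {1..n}"
  shows "map_add n (index_map n s) (constant_map n (Elt (s k) q)) = column_map n k q {1..n} s"
proof
  fix x show "map_add n (index_map n s) (constant_map n (Elt (s k) q)) x = column_map n k q {1..n} s x"
    using assms
    by (cases x) (auto simp: map_add_def index_map_def constant_map_def column_map_def dest: inj_onD)
qed

lemma map_add_constant_column:
  "map_add n (constant_map n (Elt p r)) (column_map n k q D s)
     = column_map n k q {i \<in> D. s i = r} (\<lambda>_. p)"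
  by (rule ext, case_tac x) (auto simp: map_add_def constant_map_def column_map_def)

lemma map_add_column_constant:
  "map_add n (column_map n k q D s) (constant_map n (Elt p r))
     = column_map n k r (if q = p then D else {}) s"
  by (rule ext, case_tac x) (auto simp: map_add_def constant_map_def column_map_def)

text \<open>Inside a common column the inner indices \<open>q\<close> and \<open>s' i\<close> must
  agree, which cuts the domain down to a fibre of \<open>s'\<close>.\<close>

lemma map_add_column_column:
  "map_add n (column_map n k q D s) (column_map n k' q' D' s')
     = column_map n k q' (if k = k' then {i \<in> D \<inter> D'. s' i = q} else {}) s"
  by (rule ext, case_tac x) (auto simp: map_add_def column_map_def)

text \<open>Nonzero images of the first map lie in column \<open>q\<close>, which the second map
  kills unless \<open>q = k'\<close>; in that case the partial injections compose.\<close>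

lemma map_mult_column_column:
  assumes "k \<in> {1..n}" "q \<in> {1..n}" "D \<subseteq> {1..n}" "s ` D \<subseteq> {1..n}"
  shows "map_mult n (column_map n k q D s) (column_map n k' q' D' s')
     = column_map n k q' (if q = k' then {i \<in> D. s i \<in> D'} else {}) (s' \<circ> s)"
proof
  fix x show "map_mult n (column_map n k q D s) (column_map n k' q' D' s') x
     = column_map n k q' (if q = k' then {i \<in> D. s i \<in> D'} else {}) (s' \<circ> s) x"
    using assms
    by (cases x) (auto simp: map_mult_def compose_def column_map_def image_subset_iff)
qed

lemma map_mult_constant:
  assumes "c \<in> brandt_carrier n"
  shows "map_mult n (constant_map n c) f = constant_map n (f c)"
  using assms by (auto simp: map_mult_def compose_def constant_map_def)

lemma map_mult_constant_right:
  assumes "f \<in> brandt_maps n"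
  shows "map_mult n f (constant_map n c) = constant_map n c"
  using assms by (auto simp: map_mult_def compose_def constant_map_def brandt_maps_def fun_eq_iff)

section \<open>Closure properties of column maps\<close>

text \<open>Sums of two column maps, and sums with a nonzero constant on the left, have their domain
  inside such a fibre.\<close>

lemma inj_on_fibre_subset_singleton:
  assumes "inj_on s D"
  shows "\<exists>j. {i \<in> D. s i = r} \<subseteq> {j}"
  using assms by (auto simp: inj_on_def)

lemma map_mult_column_maps:
  assumes "f \<in> column_maps n" "g \<in> column_maps n"
  shows "map_mult n f g \<in> column_maps n"
proof -
  obtain k q D s where f: "f = column_map n k q D s" "k \<in> {1..n}" "q \<in> {1..n}" "D \<subseteq> {1..n}"
    "inj_on s D" "s ` D \<subseteq> {1..n}" "D = {1..n} \<or> (\<exists>j. D \<subseteq> {j})"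
    using assms(1) by (rule column_mapsE)
  obtain k' q' D' s' where g: "g = column_map n k' q' D' s'" "k' \<in> {1..n}" "q' \<in> {1..n}"
    "D' \<subseteq> {1..n}" "inj_on s' D'" "s' ` D' \<subseteq> {1..n}" "D' = {1..n} \<or> (\<exists>j. D' \<subseteq> {j})"
    using assms(2) by (rule column_mapsE)
  let ?E = "{i \<in> D. s i \<in> D'}"
  have "inj_on (s' \<circ> s) ?E"
    using f(5) g(5) by (auto simp: inj_on_def)
  moreover have "?E = {1..n} \<or> (\<exists>j. ?E \<subseteq> {j})"
    using f(7)
  proof
    assume D: "D = {1..n}"
    from g(7) show ?thesis
    proof
      assume "D' = {1..n}"
      then show ?thesis using D f(6) by auto
    next
      assume "\<exists>j. D' \<subseteq> {j}"
      then obtain j where "D' \<subseteq> {j}" ..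
      \<comment> \<open>A domain \<open>D'\<close> with at most one point pulls back under the
        injective \<open>s\<close> to at most one point.\<close>
      then have "?E \<subseteq> {i \<in> D. s i = j}" by auto
      then show ?thesis
        using inj_on_fibre_subset_singleton[OF f(5), of j] by blast
    qed
  qed blast
  moreover have "(s' \<circ> s) ` ?E \<subseteq> {1..n}" "?E \<subseteq> {1..n}"
    using f(4) g(6) by auto
  ultimately show ?thesis
    unfolding f(1) g(1) map_mult_column_column[OF f(2,3,4,6)]
    using f(2) g(3) by (intro column_mapsI) (auto split: if_splits)
qed

lemma column_maps_subset: "column_maps n \<subseteq> brandt_maps n"
proof
  fix f assume "f \<in> column_maps n"
  then obtain k q D s where f: "f = column_map n k q D s" "q \<in> {1..n}" "s ` D \<subseteq> {1..n}"
    by (rule column_mapsE)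
  have "f x \<in> brandt_carrier n" if "x \<in> brandt_carrier n" for x
    using f that by (cases x) (auto simp: column_map_def image_subset_iff)
  then show "f \<in> brandt_maps n"
    using f(1) by (auto simp: brandt_maps_def column_map_def)
qed

lemma column_maps_Theta: "f \<in> column_maps n \<Longrightarrow> f Theta = Theta"
  by (auto simp: column_maps_def column_map_def)

text \<open>At a nonzero value the second index of the argument is \<open>k\<close>, and injectivity
  of \<open>s\<close> recovers the first. Uniqueness of inverses rests on this cancellation.\<close>

lemma column_maps_inj:
  assumes "f \<in> column_maps n" "x \<in> brandt_carrier n" "y \<in> brandt_carrier n"
    "f x = f y" "f x \<noteq> Theta"
  shows "x = y"
  using assms(1)
proof (rule column_mapsE)
  fix k q D s assume "f = column_map n k q D s" "inj_on s D"
  then show ?thesis using assms(2-)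
    by (cases x; cases y) (auto simp: column_map_def dest: inj_onD split: if_splits)
qed

lemma map_add_constant_column_maps:
  assumes "c \<in> brandt_carrier n" "f \<in> column_maps n"
  shows "map_add n (constant_map n c) f \<in> column_maps n"
  using assms(2)
proof (rule column_mapsE)
  fix k q D s
  assume f: "f = column_map n k q D s" "k \<in> {1..n}" "q \<in> {1..n}" "D \<subseteq> {1..n}"
    "inj_on s D" "s ` D \<subseteq> {1..n}" 
  show ?thesis
  proof (cases c)
    case Theta
    have "map_add n (constant_map n c) f = constant_map n Theta"
      by (auto simp: Theta map_add_def constant_map_def)
    then show ?thesis
      using f(2) constant_map_Theta_in_column_maps[of n] by simp
  next
    case (Elt p r)
    \<comment> \<open>The new row map is constant, hence injective only on a domain with at most one
      point.\<close>
    have "\<exists>j. {i \<in> D. s i = r} \<subseteq> {j}"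
      using f(5) by (rule inj_on_fibre_subset_singleton)
    moreover have "p \<in> {1..n}"
      using assms(1) Elt by simp
    ultimately show ?thesis
      unfolding Elt f(1) map_add_constant_column
      using f(2-) by (intro column_mapsI) (auto simp: inj_on_def)
  qed
qed

lemma map_add_column_maps_constant:
  assumes "c \<in> brandt_carrier n" "f \<in> column_maps n"
  shows "map_add n f (constant_map n c) \<in> column_maps n"
  using assms(2)
proof (rule column_mapsE)
  fix k q D s
  assume f: "f = column_map n k q D s" "k \<in> {1..n}" "q \<in> {1..n}" "D \<subseteq> {1..n}"
    "inj_on s D" "s ` D \<subseteq> {1..n}" "D = {1..n} \<or> (\<exists>j. D \<subseteq> {j})"
  show ?thesis
  proof (cases c)
    case Theta
    have "map_add n f (constant_map n c) = constant_map n Theta"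
      by (auto simp: Theta map_add_def constant_map_def)
    then show ?thesis
      using f(2) constant_map_Theta_in_column_maps[of n] by simp
  next
    case (Elt p r)
    then have "r \<in> {1..n}"
      using assms(1) by simp
    then show ?thesis
      unfolding Elt f(1) map_add_column_constant
      using f(2-) by (intro column_mapsI) (auto split: if_splits)
  qed
qed

lemma map_add_column_maps:
  assumes "f \<in> column_maps n" "g \<in> column_maps n"
  shows "map_add n f g \<in> column_maps n"
proof -
  obtain k q D s where f: "f = column_map n k q D s" "k \<in> {1..n}" "D \<subseteq> {1..n}"
    "inj_on s D" "s ` D \<subseteq> {1..n}"
    using assms(1) by (rule column_mapsE)
  obtain k' q' D' s' where g: "g = column_map n k' q' D' s'" "q' \<in> {1..n}" "inj_on s' D'"
    using assms(2) by (rule column_mapsE)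
  let ?E = "{i \<in> D \<inter> D'. s' i = q}"
  have "\<exists>j. ?E \<subseteq> {j}"
    using inj_on_fibre_subset_singleton[OF g(3), of q] by blast
  moreover have "inj_on s ?E"
    using f(4) by (rule inj_on_subset) auto
  ultimately show ?thesis
    unfolding f(1) g(1) map_add_column_column
    using f(2-) g(2) by (intro column_mapsI) (auto split: if_splits)
qed

section \<open>Normal form of the affine near-semiring\<close>

text \<open>Column maps together with constant maps contain the affine maps and are closed under
  both operations.\<close>

lemma affine_nearsemiring_cases:
  assumes "n \<ge> 1" "f \<in> affine_nearsemiring n"
  shows "f \<in> column_maps n \<or> (\<exists>c\<in>brandt_carrier n. f = constant_map n c)"
  using assms(2)
proof induction
  case (affine f)
  then obtain g h where f: "f = map_add n g h" "g \<in> brandt_endomorphisms n" "h \<in> constant_maps n"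
    by (auto simp: affine_maps_def)
  obtain d where d: "d \<in> brandt_carrier n" "h = constant_map n d"
    using f(3) by (rule constant_mapsE)
  from f(2) show ?case
  proof (cases rule: endomorphism_cases)
    case (const c)
    then show ?thesis
      using d f(1) map_add_constant brandt_add_closed by metis
  next
    case (index s)
    show ?thesis
    proof (cases d)
      case Theta
      have "f = constant_map n Theta"
        by (auto simp: f(1) d(2) Theta map_add_def constant_map_def)
      then show ?thesis by auto
    next
      case (Elt p q)
      \<comment> \<open>An injective self-map of a finite set is onto, so the first index
        \<open>p\<close> of the constant has a preimage \<open>k\<close>: the surviving
        column.\<close>
      have "s ` {1..n} = {1..n}"
        using index by (intro endo_inj_surj) auto
      then obtain k where "k \<in> {1..n}" "p = s k"
        using d(1) Elt by (metis Elt_in_carrier imageE)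
      then show ?thesis
        using index d Elt f(1) by (auto simp: map_add_index_constant intro!: column_mapsI)
    qed
  qed
next
  case (add f g)
  then show ?case
    using map_add_constant map_add_column_maps map_add_column_maps_constant
      map_add_constant_column_maps brandt_add_closed by metis
next
  case (mult f g)
  have "f \<in> brandt_maps n" "g \<in> brandt_maps n"
    using mult affine_nearsemiring_subset by auto
  moreover have "g c \<in> brandt_carrier n" if "c \<in> brandt_carrier n" for c
    using that \<open>g \<in> brandt_maps n\<close> by (auto simp: brandt_maps_def)
  \<comment> \<open>A composite with a constant map on either side is constant.\<close>
  ultimately show ?case
    using mult.IH map_mult_constant map_mult_constant_right map_mult_column_maps by metis
qed

lemma constant_map_in_affine_nearsemiring:
  assumes "c \<in> brandt_carrier n"
  shows "constant_map n c \<in> affine_nearsemiring n"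
proof -
  \<comment> \<open>With an idempotent left unit \<open>e\<close> of \<open>c\<close>, the constant
    map at \<open>e\<close> is an endomorphism, and adding the constant \<open>c\<close> gives an
    affine map with value \<open>c\<close>.\<close>
  obtain e where "e \<in> brandt_carrier n" "brandt_add e e = e" "brandt_add e c = c"
  proof (cases c)
    case Theta
    then show thesis by (intro that[of Theta]) simp_all
  next
    case (Elt p r)
    then show thesis using assms by (intro that[of "Elt p p"]) simp_all
  qed
  then have "constant_map n c \<in> affine_maps n"
    using assms constant_map_in_endomorphisms constant_map_in_constant_maps map_add_constant
    unfolding affine_maps_def by (metis (mono_tags, lifting) mem_Collect_eq)
  then show ?thesis by (rule affine_nearsemiring.affine)
qed

lemma full_column_map_in_affine_nearsemiring:
  assumes "k \<in> {1..n}" "q \<in> {1..n}" "inj_on s {1..n}" "s ` {1..n} \<subseteq> {1..n}"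
  shows "column_map n k q {1..n} s \<in> affine_nearsemiring n"
proof -
  have "constant_map n (Elt (s k) q) \<in> constant_maps n"
    using assms by (intro constant_map_in_constant_maps) (auto simp: image_subset_iff)
  then have "column_map n k q {1..n} s \<in> affine_maps n"
    using map_add_index_constant[OF assms(3,1), of q] index_map_in_endomorphisms[OF assms(3,4)]
    unfolding affine_maps_def by force
  then show ?thesis by (rule affine_nearsemiring.affine)
qed

lemma column_maps_subset_affine_nearsemiring: "column_maps n \<subseteq> affine_nearsemiring n"
proof
  fix f assume "f \<in> column_maps n"
  then obtain k q D s where f: "f = column_map n k q D s" "k \<in> {1..n}" "q \<in> {1..n}" "D \<subseteq> {1..n}"
    "inj_on s D" "s ` D \<subseteq> {1..n}" "D = {1..n} \<or> (\<exists>j. D \<subseteq> {j})"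
    by (rule column_mapsE)
  consider "D = {1..n}" | "D = {}" | j where "D = {j}"
    using f(7) by blast
  then show "f \<in> affine_nearsemiring n"
  proof cases
    case 1
    then show ?thesis
      using f full_column_map_in_affine_nearsemiring by simp
  next
    case 2
    then show ?thesis
      using constant_map_in_affine_nearsemiring[of Theta n] f(1) constant_map_Theta by simp
  next
    case (3 j)
    \<comment> \<open>Adding \<open>Elt (s j) j\<close> on the left keeps only row \<open>j\<close>
      of the total map with identity row map, and sends it to row \<open>s j\<close>.\<close>
    have "map_add n (constant_map n (Elt (s j) j)) (column_map n k q {1..n} id)
        \<in> affine_nearsemiring n"
      using f(2-6) 3
      by (intro affine_nearsemiring.add constant_map_in_affine_nearsemiring
          full_column_map_in_affine_nearsemiring) auto
    moreover have "map_add n (constant_map n (Elt (s j) j)) (column_map n k q {1..n} id) = f"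
      unfolding map_add_constant_column f(1) using f(4) 3
      by (auto simp: column_map_def fun_eq_iff split: brandt.split)
    ultimately show ?thesis by simp
  qed
qed

section \<open>Supports\<close>

lemma card_support_constant_map: "c \<noteq> Theta \<Longrightarrow> card (map_support n (constant_map n c)) = n\<^sup>2 + 1"
  using card_brandt_carrier by (simp add: map_support_def constant_map_def)

lemma card_support_column_maps:
  assumes "f \<in> column_maps n"
  shows "card (map_support n f) < n\<^sup>2 + 1"
proof -
  have "map_support n f \<subset> brandt_carrier n"
    unfolding map_support_def using column_maps_Theta[OF assms] Theta_in_carrier by blast
  then have "card (map_support n f) < card (brandt_carrier n)"
    by (intro psubset_card_mono finite_brandt_carrier)
  then show ?thesis
    by (simp only: card_brandt_carrier)
qed

text \<open>Column maps fix \<open>Theta\<close>, so among the normal forms only the nonzero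
  constant maps have full support.\<close>

lemma nonfull_support_eq_column_maps:
  assumes "n \<ge> 1"
  shows "affine_nearsemiring n - affine_nearsemiring_supp n (n\<^sup>2 + 1) = column_maps n"
proof (intro equalityI subsetI)
  fix f assume f: "f \<in> affine_nearsemiring n - affine_nearsemiring_supp n (n\<^sup>2 + 1)"
  then consider "f \<in> column_maps n" | c where "f = constant_map n c"
    using affine_nearsemiring_cases[OF assms] by blast
  then show "f \<in> column_maps n"
  proof cases
    case (2 c)
    then have "c = Theta"
      using f card_support_constant_map by (auto simp: affine_nearsemiring_supp_def)
    then show ?thesis
      using 2 constant_map_Theta_in_column_maps[OF assms] by simp
  qed
next
  fix f assume "f \<in> column_maps n"
  then show "f \<in> affine_nearsemiring n - affine_nearsemiring_supp n (n\<^sup>2 + 1)"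
    using column_maps_subset_affine_nearsemiring card_support_column_maps
    by (fastforce simp: affine_nearsemiring_supp_def)
qed

section \<open>Inverses under composition\<close>

lemma map_mult_apply: "x \<in> brandt_carrier n \<Longrightarrow> map_mult n f g x = g (f x)"
  by (simp add: map_mult_def compose_def)

lemma map_mult_assoc:
  assumes "f \<in> brandt_maps n"
  shows "map_mult n (map_mult n f g) h = map_mult n f (map_mult n g h)"
  using assms by (auto simp: map_mult_def compose_def brandt_maps_def fun_eq_iff)

text \<open>The inverse exchanges the columns \<open>k\<close> and \<open>q\<close> and inverts
  \<open>s\<close> on its image.\<close>

lemma column_maps_inverse_exists:
  assumes "f \<in> column_maps n"
  obtains g where "g \<in> column_maps n" "map_mult n (map_mult n f g) f = f"
    "map_mult n (map_mult n g f) g = g"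
  using assms
proof (rule column_mapsE)
  fix k q D s
  assume f: "f = column_map n k q D s" "k \<in> {1..n}" "q \<in> {1..n}" "D \<subseteq> {1..n}"
    "inj_on s D" "s ` D \<subseteq> {1..n}" "D = {1..n} \<or> (\<exists>j. D \<subseteq> {j})"
  define g where "g = column_map n q k (s ` D) (inv_into D s)"
  \<comment> \<open>The inverse stays in the family: a total injective \<open>s\<close> is onto, so
    the inverse is total as well.\<close>
  have "s ` D = {1..n} \<or> (\<exists>j. s ` D \<subseteq> {j})"
    using f(7)
  proof
    assume "D = {1..n}"
    then show ?thesis using f(5,6) endo_inj_surj[of "{1..n}" s] by auto
  qed auto
  then have g: "g \<in> column_maps n"
    unfolding g_def using f(2-6)
    by (intro column_mapsI) (auto simp: inj_on_inv_into)
  have "map_mult n (map_mult n f g) f x = f x" for x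
    unfolding f(1) g_def using f(2-6) by (cases x)
      (auto simp: map_mult_def compose_def column_map_def image_subset_iff subset_iff)
  moreover have "map_mult n (map_mult n g f) g x = g x" for x
    unfolding f(1) g_def using f(2-6) by (cases x)
      (auto simp: map_mult_def compose_def column_map_def image_subset_iff subset_iff)
  ultimately show thesis using g that by blast
qed

text \<open>Injectivity cancels the outer factor of \<open>f g f = f\<close> and \<open>g f g = g\<close>, so \<open>x g = y \<noteq> \<vartheta>\<close> forces
  \<open>y f = x\<close>, which in turn forces \<open>x h = y\<close>.\<close>
lemma column_maps_inverse_agree:
  assumes "f \<in> column_maps n" "g \<in> column_maps n" "h \<in> column_maps n"
    and gfg: "map_mult n (map_mult n g f) g = g" and fhf: "map_mult n (map_mult n f h) f = f"
    and x: "x \<in> brandt_carrier n" and gx: "g x \<noteq> Theta"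
  shows "h x = g x"
proof -
  have closed: "u y \<in> brandt_carrier n" if "u \<in> column_maps n" "y \<in> brandt_carrier n" for u y
    using that column_maps_subset by (fastforce simp: brandt_maps_def)
  have "g (f (g x)) = g x"
    using gfg x map_mult_apply by metis
  then have fgx: "f (g x) = x"
    using column_maps_inj[OF assms(2)] closed assms x gx by metis
  have "x \<noteq> Theta"
    using gx column_maps_Theta[OF assms(2)] by auto
  moreover have "f (h (f (g x))) = f (g x)"
    using fhf closed[OF assms(2) x] map_mult_apply by metis
  ultimately have "h (f (g x)) = g x"
    using column_maps_inj[OF assms(1)] closed assms x fgx by metis
  then show ?thesis using fgx by simp
qed

text \<open>The hypotheses are symmetric in \<open>g\<close> and \<open>h\<close>: whichever is
  nonzero at \<open>x\<close> forces the other to agree there.\<close>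

lemma column_maps_inverse_unique:
  assumes "f \<in> column_maps n" "g \<in> column_maps n" "h \<in> column_maps n"
    "map_mult n (map_mult n f g) f = f" "map_mult n (map_mult n g f) g = g"
    "map_mult n (map_mult n f h) f = f" "map_mult n (map_mult n h f) h = h"
  shows "g = h"
proof
  fix x show "g x = h x"
  proof (cases "x \<in> brandt_carrier n")
    case True
    then show ?thesis
      using column_maps_inverse_agree[of f n g h x] column_maps_inverse_agree[of f n h g x] assms
      by metis
  next
    \<comment> \<open>Both maps are extensional and share the default value off the carrier.\<close>
    case False
    then have "u x = undefined" if "u \<in> column_maps n" for u
      using that column_maps_subset unfolding brandt_maps_def by (blast intro: PiE_arb)
    then show ?thesis using assms(2,3) by metis
  qed
qed

theorem theorem4p11:
  fixes n :: nat
  assumes "n \<ge> 2"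
  shows "inverse_semigroup_on
    (affine_nearsemiring n - affine_nearsemiring_supp n (n\<^sup>2 + 1)) (map_mult n)"
proof -
  have n: "n \<ge> 1" using assms by simp
  have "semigroup_on (column_maps n) (map_mult n)"
    unfolding semigroup_on_def
    using constant_map_Theta_in_column_maps[OF n] map_mult_column_maps map_mult_assoc
      column_maps_subset by blast
  moreover have "\<exists>!g. g \<in> column_maps n \<and> map_mult n (map_mult n f g) f = f \<and>
      map_mult n (map_mult n g f) g = g" if f: "f \<in> column_maps n" for f
  proof -
    obtain g where "g \<in> column_maps n" "map_mult n (map_mult n f g) f = f"
      "map_mult n (map_mult n g f) g = g"
      using f by (rule column_maps_inverse_exists)
    then show ?thesis
      using column_maps_inverse_unique[OF f] by blast
  qed
  ultimately show ?thesis
    unfolding nonfull_support_eq_column_maps[OF n] inverse_semigroup_on_def by blast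
qed

end
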